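(* Let $\alpha,\beta\in(0,1)$. For every $m\in\{1,2,\dots\}$ and every junction tree $T\in\mathsf{T}_m$, the transition probability $\mathbf{K}_m=\mathbf{K}_m^{\alpha,\beta}$ of the junction-tree expander satisfies: (i) $\operatorname{Supp}(\mathbf{K}_m(T,\cdot))\subseteq \mathsf{T}_{m+1}$; (ii) $g(T_+)[\{y_\ell\}_{\ell=1}^m]=g(T)$ for all $T_+\in\operatorname{Supp}(\mathbf{K}_m(T,\cdot))$.
   Context: Graphs are finite, undirected, without loops. A clique is a complete vertex set that is maximal with respect to inclusion. $G[W]$ is the subgraph of $G$ induced by the vertex set $W$. A graph $G$ is decomposable if its cliques can be arranged in a junction tree, i.e. a tree whose nodes are the cliques of $G$ and such that for any two cliques $c,c'$ the intersection $c\cap c'$ is contained in every node on the unique path between $c$ and $c'$ (junction tree property). Edges of a junction tree are called links; the link $(a,b)$ has associated separator $s_{a,b}=a\cap b$ (which may be empty). Fix distinct vertices $y_1,y_2,\dots$. $\mathsf{T}_m$ is the set of all junction trees of all decomposable graphs with vertex set $\{y_1,\dots,y_m\}$. For a tree $T$ whose nodes are sets of vertices, $g(T)$ is the underlying graph: its vertex set is the union of the nodes, and two distinct vertices are adjacent iff they belong to a common node. $N_T(c)$ is the set of neighbors of node $c$ in $T$. $\operatorname{Supp}(h)=\{x:h(x)>0\}$. Subtree kernel. For a tree $T=(V,E)$ a random (possibly empty) subtree $T'=(V',E')$ is drawn with probability $\mathbf{S}^{\alpha,\beta}(T,T')=1-\beta$ if $T'=(\emptyset,\emptyset)$ and $\beta|V'|\alpha^{|V'|-1}(1-\alpha)^{w}/|V|$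 otherwise, where $w$ is the number of connected components of $T[V\setminus V']$. (A subtree is a connected subgraph.) Junction-tree expander. Given $T=(V,E)\in\mathsf{T}_m$, draw $T'=(V',E')\sim\mathbf{S}^{\alpha,\beta}(T,\cdot)$. If $T'$ is empty: add the new node $\{y_{m+1}\}$ to $T$, joined by a link to an arbitrary node of $T$; delete all links with empty separator; and reconnect the resulting forest into a tree by adding links, chosen uniformly at random among all possible ways to do so. Output this tree. If $T'$ is nonempty: enumerate $V'=\{c_1,\dots,c_{|V'|}\}$. For each $j$ put $z_j=\bigcup_{c\in N_{T'}(c_j)}s_{c_j,c}$. Independently over $j$, draw $q_j$ uniformly from the nonempty subsets of $c_j\setminus z_j$ if $z_j=s_{c_j,c}$ for some $c\in N_{T'}(c_j)$, and uniformly from all subsets of $c_j\setminus z_j$ otherwise. Put $d_j=z_j\cup q_j$ and add the new node $d_j^+=d_j\cup\{y_{m+1}\}$. For each link $(c_j,c_k)$ of $T'$, remove this link and add the link $(d_j^+,d_k^+)$. For each $j$ with $d_j=c_j$, delete the node $c_j$ and let all of $N_T(c_j)\setminus V'$ become neighbors of $d_j^+$. For each $j$ with $d_j\neq c_j$, add the link $(c_j,d_j^+)$, draw $n_j$ uniformly from the subsets of $\{c\in N_T(c_j)\setminus V': s_{c,c_j}\subseteq d_j\}$, and move the nodes in $n_j$ from being neighbors of $c_j$ to being neighbors of $d_j^+$. (If a node of $V$ that is a neighbor of $c_j$ outside $V'$ is concerned, it is unaffected otherwise.) Output the resulting graph on the nodes. $\mathbf{K}_m(T,T_+)$ denotes the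 probability that this procedure outputs $T_+$ when the input is $T$. *)

theory Defs
  imports "HOL-Probability.Product_PMF"
begin

type_synonym 'a ugraph = "'a set \<times> 'a set set"

abbreviation verts :: "'a ugraph \<Rightarrow> 'a set" where "verts \<equiv> fst"
abbreviation edges :: "'a ugraph \<Rightarrow> 'a set set" where "edges \<equiv> snd"

definition ugraph :: "'a ugraph \<Rightarrow> bool" where
  "ugraph G \<longleftrightarrow> finite (verts G) \<and> (\<forall>e\<in>edges G. e \<subseteq> verts G \<and> card e = 2)"

definition induced :: "'a ugraph \<Rightarrow> 'a set \<Rightarrow> 'a ugraph" where
  "induced G W = (verts G \<inter> W, {e \<in> edges G. e \<subseteq> W})"

definition nbrs :: "'a ugraph \<Rightarrow> 'a \<Rightarrow> 'a set" where
  "nbrs G v = {u. {v, u} \<in> edges G}"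

definition reach :: "'a ugraph \<Rightarrow> ('a \<times> 'a) set" where
  "reach G = {(u, v). u \<in> verts G \<and> v \<in> verts G \<and> (u, v) \<in> {(a, b). {a, b} \<in> edges G}\<^sup>*}"

definition components :: "'a ugraph \<Rightarrow> 'a set set" where
  "components G = verts G // reach G"

definition connected_graph :: "'a ugraph \<Rightarrow> bool" where
  "connected_graph G \<longleftrightarrow> verts G \<noteq> {} \<and> (\<forall>u\<in>verts G. \<forall>v\<in>verts G. (u, v) \<in> reach G)"

definition is_path :: "'a ugraph \<Rightarrow> 'a list \<Rightarrow> bool" where
  "is_path G p \<longleftrightarrow> p \<noteq> [] \<and> set p \<subseteq> verts G \<and> distinct p \<and> successively (\<lambda>u v. {u, v} \<in> edges G) p"

definition is_cycle :: "'a ugraph \<Rightarrow> 'a list \<Rightarrow> bool" where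
  "is_cycle G p \<longleftrightarrow> is_path G p \<and> length p \<ge> 3 \<and> {last p, hd p} \<in> edges G"

definition is_tree :: "'a ugraph \<Rightarrow> bool" where
  "is_tree G \<longleftrightarrow> ugraph G \<and> connected_graph G \<and> (\<nexists>p. is_cycle G p)"

definition cliques :: "'a ugraph \<Rightarrow> 'a set set" where
  "cliques G =
    (let complete = (\<lambda>C. C \<subseteq> verts G \<and> (\<forall>u\<in>C. \<forall>v\<in>C. u \<noteq> v \<longrightarrow> {u, v} \<in> edges G))
     in {C. complete C \<and> (\<forall>D. complete D \<and> C \<subseteq> D \<longrightarrow> D = C)})"

definition junction_property :: "'a set ugraph \<Rightarrow> bool" where
  "junction_property T \<longleftrightarrow> (\<forall>p. is_path T p \<longrightarrow> (\<forall>b\<in>set p. hd p \<inter> last p \<subseteq> b))"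

definition junction_tree_of :: "'a ugraph \<Rightarrow> 'a set ugraph \<Rightarrow> bool" where
  "junction_tree_of G T \<longleftrightarrow> is_tree T \<and> verts T = cliques G \<and> junction_property T"

definition decomposable :: "'a ugraph \<Rightarrow> bool" where
  "decomposable G \<longleftrightarrow> ugraph G \<and> (\<exists>T. junction_tree_of G T)"

definition junction_trees :: "(nat \<Rightarrow> 'a) \<Rightarrow> nat \<Rightarrow> 'a set ugraph set" where
  "junction_trees y m =
    {T. \<exists>G. decomposable G \<and> verts G = y ` {1..m} \<and> junction_tree_of G T}"

definition underlying :: "'a set ugraph \<Rightarrow> 'a ugraph" where
  "underlying T =
    (\<Union> (verts T), {{u, v} | u v. u \<noteq> v \<and> (\<exists>c\<in>verts T. u \<in> c \<and> v \<in> c)})"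

definition subtrees :: "'a ugraph \<Rightarrow> 'a ugraph set" where
  "subtrees T = {T'. ugraph T' \<and> verts T' \<subseteq> verts T \<and> edges T' \<subseteq> edges T \<and>
                     (T' = ({}, {}) \<or> connected_graph T')}"

definition subtree_kernel :: "real \<Rightarrow> real \<Rightarrow> 'a ugraph \<Rightarrow> 'a ugraph \<Rightarrow> real" where
  "subtree_kernel \<alpha> \<beta> T T' =
    (if T' = ({}, {}) then 1 - \<beta>
     else \<beta> * real (card (verts T')) * \<alpha> ^ (card (verts T') - 1)
          * (1 - \<alpha>) ^ card (components (induced T (verts T - verts T')))
          / real (card (verts T)))"

text \<open>
  Throughout, \<open>x\<close> is the vertex to be added. The nodes \<open>c\<^sub>1, c\<^sub>2, \<dots>\<close> of the drawn subtree index
  themselves, so the families \<open>z\<^sub>j, q\<^sub>j, d\<^sub>j, n\<^sub>j\<close> become functions of the node \<open>c\<close>.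
  The separator of a link \<open>{a, b}\<close> is \<open>a \<inter> b = \<Inter> {a, b}\<close>.
\<close>

text \<open>The empty subtree; \<open>a\<close> is the node of \<open>T\<close> to which the new node is first attached.\<close>

definition expand_empty :: "'a \<Rightarrow> 'a set \<Rightarrow> 'a set ugraph \<Rightarrow> 'a set ugraph pmf" where
  "expand_empty x a T =
    (let V = insert {x} (verts T);
         F = {e \<in> insert {{x}, a} (edges T). \<Inter> e \<noteq> {}}
     in pmf_of_set {R. is_tree R \<and> verts R = V \<and> F \<subseteq> edges R})"

definition sep_union :: "'a set ugraph \<Rightarrow> 'a set \<Rightarrow> 'a set" where
  "sep_union T' c = (\<Union>b\<in>nbrs T' c. c \<inter> b)"

definition q_choices :: "'a set ugraph \<Rightarrow> 'a set \<Rightarrow> 'a set set" where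
  "q_choices T' c =
    (if \<exists>b\<in>nbrs T' c. sep_union T' c = c \<inter> b
     then Pow (c - sep_union T' c) - {{}}
     else Pow (c - sep_union T' c))"

definition n_choices :: "'a set ugraph \<Rightarrow> 'a set ugraph \<Rightarrow> ('a set \<Rightarrow> 'a set) \<Rightarrow> 'a set \<Rightarrow> 'a set set set" where
  "n_choices T T' d c = Pow {b \<in> nbrs T c - verts T'. b \<inter> c \<subseteq> d c}"

text \<open>The output determined by the drawn sets. A node \<open>c\<close> with \<open>d c = c\<close> is deleted and passes on
  all its neighbours outside \<open>T'\<close>; otherwise it passes on \<open>n c\<close>.\<close>

definition rebuild ::
  "'a \<Rightarrow> 'a set ugraph \<Rightarrow> 'a set ugraph \<Rightarrow> ('a set \<Rightarrow> 'a set) \<Rightarrow> ('a set \<Rightarrow> 'a set set) \<Rightarrow> 'a set ugraph" where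
  "rebuild x T T' d n =
    (let V' = verts T';
         plus = (\<lambda>c. insert x (d c));
         moved = (\<lambda>c. if d c = c then nbrs T c - V' else n c)
     in ((verts T - {c \<in> V'. d c = c}) \<union> plus ` V',
         (edges T - edges T' - {{c, b} | c b. c \<in> V' \<and> b \<in> moved c})
         \<union> {{plus c, plus b} | c b. {c, b} \<in> edges T'}
         \<union> {{c, plus c} | c. c \<in> V' \<and> d c \<noteq> c}
         \<union> {{plus c, b} | c b. c \<in> V' \<and> b \<in> moved c}))"

definition expand_nonempty :: "'a \<Rightarrow> 'a set ugraph \<Rightarrow> 'a set ugraph \<Rightarrow> 'a set ugraph pmf" where
  "expand_nonempty x T T' =
    do {
      q \<leftarrow> Pi_pmf (verts T') {} (\<lambda>c. pmf_of_set (q_choices T' c));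
      let d = (\<lambda>c. sep_union T' c \<union> q c);
      n \<leftarrow> Pi_pmf {c \<in> verts T'. d c \<noteq> c} {} (\<lambda>c. pmf_of_set (n_choices T T' d c));
      return_pmf (rebuild x T T' d n)
    }"

definition expand :: "'a \<Rightarrow> 'a set \<Rightarrow> 'a set ugraph \<Rightarrow> 'a set ugraph \<Rightarrow> 'a set ugraph pmf" where
  "expand x a T T' = (if T' = ({}, {}) then expand_empty x a T else expand_nonempty x T T')"

text \<open>The probability that the expander with input \<open>T\<close> outputs \<open>T\<^sub>+\<close>, by the law of total probability
  over the drawn subtree. The function \<open>att\<close> selects the arbitrary node of \<open>T\<close> to which the new node
  is attached if the drawn subtree is empty.\<close>

definition expander ::
  "real \<Rightarrow> real \<Rightarrow> ('a set ugraph \<Rightarrow> 'a set) \<Rightarrow> (nat \<Rightarrow> 'a) \<Rightarrow> nat \<Rightarrow> 'a set ugraph \<Rightarrow> 'a set ugraph \<Rightarrow> real"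
  where
  "expander \<alpha> \<beta> att y m T Tp =
    (\<Sum>T'\<in>subtrees T. subtree_kernel \<alpha> \<beta> T T' * pmf (expand (y (m + 1)) (att T) T T') Tp)"

definition Supp :: "('b \<Rightarrow> real) \<Rightarrow> 'b set" where
  "Supp h = {x. h x > 0}"

end

(*
For a tree whose nodes are sets, the junction property says that the nodes containing any given
vertex are connected by links whose separators contain it, and by the Helly property of subtrees
every complete set of the underlying graph then lies in a single node. Hence a tree with the
junction property whose nodes form an antichain is a junction tree of its underlying graph.

For a nonempty subtree, contracting each expanded copy onto its original maps the output onto T:
every link of T lifts to a link with the same old vertices available in its separator, so walks
lift. This gives connectedness and the junction property for old vertices; the new vertex lives
exactly on a copy of T'. Acyclicity follows by counting nodes and links. The nonemptiness
requirement on q is what keeps the copies an antichain. For the empty subtree, every walk of T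
through nodes with a common vertex uses only links with nonempty separator, and those survive.
*)

theory Submission
  imports Defs
begin

section \<open>Trees\<close>

text \<open>The edge relation inside \<open>reach\<close>, taken of an edge set alone so that walks
  can be compared after deleting or adding edges.\<close>

definition adj :: "'a set set \<Rightarrow> ('a \<times> 'a) set" where
  "adj E = {(a, b). {a, b} \<in> E}"

lemma adj_iff [simp]: "(a, b) \<in> adj E \<longleftrightarrow> {a, b} \<in> E"
  by (simp add: adj_def)

lemma sym_adj: "sym (adj E)"
  by (auto simp: sym_def insert_commute)

lemma rtrancl_adj_sym: "(a, b) \<in> (adj E)\<^sup>* \<Longrightarrow> (b, a) \<in> (adj E)\<^sup>*"
  using sym_adj sym_rtrancl symD by metis

lemma rtrancl_adj_mono: "(a, b) \<in> (adj E)\<^sup>* \<Longrightarrow> E \<subseteq> F \<Longrightarrow> (a, b) \<in> (adj F)\<^sup>*"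
  by (rule rtrancl_mono[THEN subsetD, of "adj E"]) (auto simp: adj_def)

lemma reach_iff: "(u, v) \<in> reach G \<longleftrightarrow> u \<in> verts G \<and> v \<in> verts G \<and> (u, v) \<in> (adj (edges G))\<^sup>*"
  by (simp add: reach_def adj_def)

lemma connected_graph_iff:
  "connected_graph G \<longleftrightarrow>
     verts G \<noteq> {} \<and> (\<forall>u\<in>verts G. \<forall>v\<in>verts G. (u, v) \<in> (adj (edges G))\<^sup>*)"
  by (auto simp: connected_graph_def reach_iff)

lemma ugraph_edge:
  assumes "ugraph G" "{a, b} \<in> edges G"
  shows "a \<in> verts G" "b \<in> verts G" "a \<noteq> b"
  using assms by (auto simp: ugraph_def)

lemma ugraph_edgeE:
  assumes "ugraph G" "e \<in> edges G"
  obtains a b where "e = {a, b}" "a \<in> verts G" "b \<in> verts G" "a \<noteq> b"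
proof -
  from assms have "card e = 2" by (auto simp: ugraph_def)
  then obtain a b where ab: "e = {a, b}" "a \<noteq> b" by (auto simp: card_2_iff)
  then show ?thesis using that assms ugraph_edge by metis
qed

lemma ugraph_finite_edges: "ugraph G \<Longrightarrow> finite (edges G)"
  by (rule finite_subset[of _ "Pow (verts G)"]) (auto simp: ugraph_def)

text \<open>When the next vertex is already on the path, the path is cut back to it. The start is
  listed apart from \<open>\<Union>E\<close> because the trivial path uses no edge.\<close>

lemma rtrancl_simple_path:
  assumes "(a, b) \<in> (adj E)\<^sup>*"
  obtains p where "p \<noteq> []" "hd p = a" "last p = b" "distinct p"
    "successively (\<lambda>u v. {u, v} \<in> E) p" "set p \<subseteq> insert a (\<Union>E)"
proof -
  from assms have "\<exists>p. p \<noteq> [] \<and> hd p = a \<and> last p = b \<and> distinct p \<and>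
    successively (\<lambda>u v. {u, v} \<in> E) p \<and> set p \<subseteq> insert a (\<Union>E)"
  proof (induction rule: rtrancl_induct)
    case base
    then show ?case by (intro exI[of _ "[a]"]) auto
  next
    case (step b c)
    then obtain p where p: "p \<noteq> []" "hd p = a" "last p = b" "distinct p"
      "successively (\<lambda>u v. {u, v} \<in> E) p" "set p \<subseteq> insert a (\<Union>E)" by blast
    show ?case
    proof (cases "c \<in> set p")
      case True
      then obtain ys zs where yz: "p = ys @ c # zs" by (meson split_list)
      with p have "hd (ys @ [c]) = a" by (cases ys) auto
      with p yz show ?thesis
        by (intro exI[of _ "ys @ [c]"]) (auto simp: successively_append_iff)
    next
      case False
      with p step.hyps(2) show ?thesis
        by (intro exI[of _ "p @ [c]"]) (auto simp: successively_append_iff)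
    qed
  qed
  then show ?thesis using that by blast
qed

lemma path_rtrancl:
  "successively (\<lambda>u v. {u, v} \<in> E) p \<Longrightarrow> p \<noteq> [] \<Longrightarrow> (hd p, last p) \<in> (adj E)\<^sup>*"
proof (induction p rule: induct_list012)
  case (3 x y zs)
  then show ?case by (auto intro: converse_rtrancl_into_rtrancl[of x y])
qed auto

text \<open>Opening a cycle at its closing edge leaves a path between the ends of that edge, and
  conversely. Acyclicity thus becomes the statement that every edge is a bridge, the form used from
  here on.\<close>

lemma cycle_iff_chord:
  assumes G: "ugraph G"
  shows "(\<exists>p. is_cycle G p) \<longleftrightarrow>
    (\<exists>a b. {a, b} \<in> edges G \<and> (a, b) \<in> (adj (edges G - {{a, b}}))\<^sup>*)"
proof
  assume "\<exists>p. is_cycle G p"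
  then obtain p where p: "p \<noteq> []" "distinct p" "length p \<ge> 3" "{last p, hd p} \<in> edges G"
    "successively (\<lambda>u v. {u, v} \<in> edges G) p"
    by (auto simp: is_cycle_def is_path_def)
  let ?E = "edges G - {{hd p, last p}}"
  have "successively (\<lambda>u v. {u, v} \<in> ?E) p"
    unfolding successively_conv_nth
  proof (intro allI impI)
    fix i assume i: "Suc i < length p"
    \<comment> \<open>By distinctness, consecutive entries that are also first and last would leave
      only two vertices.\<close>
    have "{p ! i, p ! Suc i} \<noteq> {hd p, last p}"
      using i p by (auto simp: doubleton_eq_iff hd_conv_nth last_conv_nth nth_eq_iff_index_eq)
    then show "{p ! i, p ! Suc i} \<in> ?E"
      using p(5) i by (auto simp: successively_conv_nth)
  qed
  from path_rtrancl[OF this p(1)] p(4)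
  show "\<exists>a b. {a, b} \<in> edges G \<and> (a, b) \<in> (adj (edges G - {{a, b}}))\<^sup>*"
    by (intro exI[of _ "hd p"] exI[of _ "last p"]) (auto simp: insert_commute)
next
  assume "\<exists>a b. {a, b} \<in> edges G \<and> (a, b) \<in> (adj (edges G - {{a, b}}))\<^sup>*"
  then obtain a b where ab: "{a, b} \<in> edges G" "(a, b) \<in> (adj (edges G - {{a, b}}))\<^sup>*"
    by blast
  note V = ugraph_edge[OF G ab(1)]
  obtain p where p: "p \<noteq> []" "hd p = a" "last p = b" "distinct p"
    "successively (\<lambda>u v. {u, v} \<in> edges G - {{a, b}}) p"
    "set p \<subseteq> insert a (\<Union>(edges G - {{a, b}}))"
    by (rule rtrancl_simple_path[OF ab(2)])
  \<comment> \<open>Length 1 would give \<open>a = b\<close>, and length 2 would use the deleted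
    edge.\<close>
  have "length p \<ge> 3"
  proof (rule ccontr)
    assume "\<not> 3 \<le> length p"
    moreover have "length p \<noteq> 0" using p(1) by simp
    ultimately have "length p = 1 \<or> length p = 2" by linarith
    then show False using p V by (auto simp: length_Suc_conv numeral_2_eq_2)
  qed
  moreover have "successively (\<lambda>u v. {u, v} \<in> edges G) p"
    using p(5) by (auto simp: successively_conv_nth)
  moreover have "set p \<subseteq> verts G"
    using p(6) V(1) G by (auto simp: ugraph_def)
  ultimately have "is_cycle G p"
    using p ab(1) by (auto simp: is_cycle_def is_path_def insert_commute)
  then show "\<exists>p. is_cycle G p" by blast
qed

section \<open>Bridges, spanning sets and edge counts\<close>

lemma tree_edge_cut:
  assumes "is_tree G" "{a, b} \<in> edges G"
  shows "(a, b) \<notin> (adj (edges G - {{a, b}}))\<^sup>*"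
  using assms cycle_iff_chord[of G] by (auto simp: is_tree_def)

lemma rtrancl_first_exit:
  assumes "(a, b) \<in> r\<^sup>*" "a \<in> S" "b \<notin> S"
  obtains w c where "(a, w) \<in> (r \<inter> S \<times> S)\<^sup>*" "(w, c) \<in> r" "w \<in> S" "c \<notin> S"
proof -
  have "b \<in> S \<and> (a, b) \<in> (r \<inter> S \<times> S)\<^sup>* \<or>
    (\<exists>w c. (a, w) \<in> (r \<inter> S \<times> S)\<^sup>* \<and> (w, c) \<in> r \<and> w \<in> S \<and> c \<notin> S)"
    using assms(1)
  proof (induction rule: rtrancl_induct)
    case base
    then show ?case using assms(2) by blast
  next
    case (step y z)
    show ?case
    proof (cases "y \<in> S \<and> (a, y) \<in> (r \<inter> S \<times> S)\<^sup>* \<and> z \<in> S")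
      case True
      with step.hyps(2) have "(y, z) \<in> r \<inter> S \<times> S" by blast
      with True show ?thesis by (meson rtrancl.rtrancl_into_rtrancl)
    next
      case False
      with step show ?thesis by blast
    qed
  qed
  then show ?thesis using assms(3) that by blast
qed

text \<open>Greedy growth from \<open>r\<close>: as long as the reached set is not all of
  \<open>V\<close>, some edge of \<open>E\<close> leaves it and adds one vertex.\<close>

lemma spanning_edges:
  assumes "finite V" "r \<in> V" "\<And>v. v \<in> V \<Longrightarrow> (r, v) \<in> (adj E)\<^sup>*" "\<And>e. e \<in> E \<Longrightarrow> e \<subseteq> V"
  obtains P where "P \<subseteq> E" "finite P" "card P + 1 = card V"
    "\<And>v. v \<in> V \<Longrightarrow> (r, v) \<in> (adj P)\<^sup>*"
proof -
  \<comment> \<open>All edges of \<open>P\<close> lie inside \<open>S\<close>, so an edge leaving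
    \<open>S\<close> is new and both cardinalities grow by one.\<close>
  have "\<exists>S P. S \<subseteq> V \<and> r \<in> S \<and> card S = k + 1 \<and> P \<subseteq> E \<and> finite P \<and> card P = k \<and>
      (\<forall>e\<in>P. e \<subseteq> S) \<and> (\<forall>v\<in>S. (r, v) \<in> (adj P)\<^sup>*)" if "k < card V" for k
    using that
  proof (induction k)
    case 0
    show ?case by (intro exI[of _ "{r}"] exI[of _ "{}"]) (use assms(2) in auto)
  next
    case (Suc k)
    then obtain S P where SP: "S \<subseteq> V" "r \<in> S" "card S = k + 1" "P \<subseteq> E" "finite P" "card P = k"
      "\<forall>e\<in>P. e \<subseteq> S" "\<forall>v\<in>S. (r, v) \<in> (adj P)\<^sup>*" by auto
    have "S \<noteq> V" using SP(3) Suc.prems by auto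
    then obtain v where v: "v \<in> V" "v \<notin> S" using SP(1) by blast
    obtain w c where wc: "(w, c) \<in> adj E" "w \<in> S" "c \<notin> S"
      by (rule rtrancl_first_exit[OF assms(3)[OF v(1)] SP(2) v(2)])
    let ?P = "insert {w, c} P"
    have "c \<in> V" using wc assms(4) by auto
    moreover have "{w, c} \<notin> P" using SP(7) wc by auto
    moreover have mono: "(r, u) \<in> (adj ?P)\<^sup>*" if "u \<in> S" for u
      using SP(8) that by (meson rtrancl_adj_mono subset_insertI)
    moreover have "(r, c) \<in> (adj ?P)\<^sup>*"
      by (rule rtrancl_into_rtrancl[OF mono[OF wc(2)]]) simp
    moreover have "finite S" using SP(1) assms(1) finite_subset by blast
    ultimately show ?case using SP wc
      by (intro exI[of _ "insert c S"] exI[of _ ?P]) auto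
  qed
  moreover have "card V > 0" using assms(1,2) card_gt_0_iff by blast
  ultimately obtain S P where SP: "S \<subseteq> V" "card S = card V - 1 + 1" "P \<subseteq> E" "finite P"
    "card P = card V - 1" "\<forall>v\<in>S. (r, v) \<in> (adj P)\<^sup>*"
    by (metis diff_less zero_less_one)
  with \<open>card V > 0\<close> have "S = V" by (intro card_subset_eq[OF assms(1)]) auto
  then show ?thesis using that[of P] SP \<open>card V > 0\<close> by auto
qed

text \<open>Take a spanning set \<open>P\<close> of the right size. An edge outside \<open>P\<close>
  would have its ends joined by \<open>P\<close>, contrary to being a bridge, so \<open>P\<close> is
  the whole edge set.\<close>

lemma tree_card_edges:
  assumes "is_tree G"
  shows "card (edges G) + 1 = card (verts G)"
proof -
  from assms have G: "ugraph G" "connected_graph G" by (auto simp: is_tree_def)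
  then obtain r where r: "r \<in> verts G" by (auto simp: connected_graph_def)
  obtain P where P: "P \<subseteq> edges G" "finite P" "card P + 1 = card (verts G)"
    "\<And>v. v \<in> verts G \<Longrightarrow> (r, v) \<in> (adj P)\<^sup>*"
    by (rule spanning_edges[of "verts G" r "edges G"])
       (use G r in \<open>auto simp: connected_graph_iff ugraph_def\<close>)
  have "edges G \<subseteq> P"
  proof
    fix e assume e: "e \<in> edges G"
    then obtain a b where ab: "e = {a, b}" "a \<in> verts G" "b \<in> verts G"
      by (rule ugraph_edgeE[OF G(1)])
    show "e \<in> P"
    proof (rule ccontr)
      assume "e \<notin> P"
      with P(1) ab have "P \<subseteq> edges G - {{a, b}}" by auto
      moreover have "(a, b) \<in> (adj P)\<^sup>*"
        using P(4)[OF ab(2)] P(4)[OF ab(3)] by (meson rtrancl_adj_sym rtrancl_trans)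
      ultimately show False
        using tree_edge_cut[OF assms] e ab(1) rtrancl_adj_mono by metis
    qed
  qed
  with P show ?thesis by (metis subset_antisym)
qed

text \<open>If some edge were not a bridge, the graph without it would still contain a spanning set,
  so there would be at least as many edges as vertices.\<close>

lemma tree_if_card_edges:
  assumes G: "ugraph G" "connected_graph G" and card: "card (edges G) + 1 \<le> card (verts G)"
  shows "is_tree G"
proof -
  have "(a, b) \<notin> (adj (edges G - {{a, b}}))\<^sup>*" if ab: "{a, b} \<in> edges G" for a b
  proof
    let ?E = "edges G - {{a, b}}"
    assume con: "(a, b) \<in> (adj ?E)\<^sup>*"
    have step: "(u, v) \<in> (adj ?E)\<^sup>*" if "(u, v) \<in> adj (edges G)" for u v
      using con rtrancl_adj_sym[OF con] that
      by (cases "{u, v} = {a, b}") (auto simp: doubleton_eq_iff)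
    have con': "(u, v) \<in> (adj ?E)\<^sup>*" if "(u, v) \<in> (adj (edges G))\<^sup>*" for u v
      using that by (induction rule: rtrancl_induct) (blast intro: step rtrancl_trans)+
    obtain r where r: "r \<in> verts G" using G(2) by (auto simp: connected_graph_def)
    obtain P where P: "P \<subseteq> ?E" "finite P" "card P + 1 = card (verts G)"
      by (rule spanning_edges[of "verts G" r ?E])
         (use G r con' in \<open>auto simp: connected_graph_iff ugraph_def\<close>)
    have fin: "finite (edges G)" by (rule ugraph_finite_edges[OF G(1)])
    then have "card P \<le> card ?E" using P(1) by (intro card_mono) auto
    also have "\<dots> < card (edges G)" using fin ab by (intro psubset_card_mono) auto
    finally show False using P(3) card by simp
  qed
  then show ?thesis using cycle_iff_chord[OF G(1)] G by (auto simp: is_tree_def)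
qed

text \<open>Otherwise the connected \<open>T'\<close> would join \<open>a\<close> and
  \<open>b\<close> without this link, which is a bridge of \<open>T\<close>.\<close>

lemma subtree_induced_edge:
  assumes T: "is_tree T" and "T' \<in> subtrees T" "{a, b} \<in> edges T" "a \<in> verts T'" "b \<in> verts T'"
  shows "{a, b} \<in> edges T'"
proof (rule ccontr)
  assume "{a, b} \<notin> edges T'"
  with assms have "edges T' \<subseteq> edges T - {{a, b}}" by (auto simp: subtrees_def)
  moreover have "(a, b) \<in> (adj (edges T'))\<^sup>*"
    using assms by (auto simp: subtrees_def connected_graph_iff)
  ultimately show False using tree_edge_cut[OF T assms(3)] rtrancl_adj_mono by metis
qed

section \<open>The junction tree property\<close>

text \<open>The links whose separator contains \<open>U\<close>. Taking \<open>U = {}\<close> treats connectedness of the tree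
  on the same footing as connectedness of the set of nodes that contain a given vertex.\<close>

definition links :: "'a set ugraph \<Rightarrow> 'a set \<Rightarrow> 'a set set set" where
  "links T U = {e \<in> edges T. \<forall>c\<in>e. U \<subseteq> c}"

lemma links_iff [simp]: "{a, b} \<in> links T U \<longleftrightarrow> {a, b} \<in> edges T \<and> U \<subseteq> a \<and> U \<subseteq> b"
  by (auto simp: links_def)

text \<open>The simple path between \<open>a\<close> and \<open>b\<close> runs through nodes
  containing \<open>a \<inter> b\<close>, hence \<open>U\<close>.\<close>

lemma junction_property_links:
  assumes T: "is_tree T" "junction_property T"
    and ab: "a \<in> verts T" "b \<in> verts T" "U \<subseteq> a" "U \<subseteq> b"
  shows "(a, b) \<in> (adj (links T U))\<^sup>*"
proof -
  from T have G: "ugraph T" and "(a, b) \<in> (adj (edges T))\<^sup>*"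
    using ab by (auto simp: is_tree_def connected_graph_iff)
  then obtain p where p: "p \<noteq> []" "hd p = a" "last p = b" "distinct p"
    "successively (\<lambda>u v. {u, v} \<in> edges T) p" "set p \<subseteq> insert a (\<Union>(edges T))"
    using rtrancl_simple_path by metis
  moreover have "\<Union>(edges T) \<subseteq> verts T" using G by (auto simp: ugraph_def)
  ultimately have "is_path T p" using ab by (auto simp: is_path_def)
  with T(2) have "a \<inter> b \<subseteq> c" if "c \<in> set p" for c
    using p(2,3) that unfolding junction_property_def by blast
  with ab have "U \<subseteq> c" if "c \<in> set p" for c using that by blast
  then have "successively (\<lambda>u v. {u, v} \<in> links T U) p"
    using successively_mono[OF p(5), of "\<lambda>u v. {u, v} \<in> links T U"] by simp
  from path_rtrancl[OF this p(1)] p show ?thesis by simp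
qed

text \<open>If a path entered a node without \<open>u\<close>, its two remaining pieces together
  with the assumed connection through nodes containing \<open>u\<close> would bypass the entering
  link, which is a bridge.\<close>

lemma junction_propertyI:
  assumes T: "is_tree T"
    and con: "\<And>u a b. a \<in> verts T \<Longrightarrow> b \<in> verts T \<Longrightarrow> u \<in> a \<Longrightarrow> u \<in> b \<Longrightarrow>
      (a, b) \<in> (adj (links T {u}))\<^sup>*"
  shows "junction_property T"
  unfolding junction_property_def
proof (intro allI impI ballI subsetI)
  fix p c u
  assume p: "is_path T p" and c: "c \<in> set p" and u: "u \<in> hd p \<inter> last p"
  from p have ps: "p \<noteq> []" "set p \<subseteq> verts T" "distinct p"
    and succ: "successively (\<lambda>u v. {u, v} \<in> edges T) p" by (auto simp: is_path_def)
  have hl: "(hd p, last p) \<in> (adj (links T {u}))\<^sup>*"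
    using ps u by (intro con) auto
  \<comment> \<open>Applies to every node of the path after the first; the first contains
    \<open>u\<close> by assumption.\<close>
  have link: "u \<in> w" if p': "p = ys @ v # w # zs" for ys v w zs
  proof (rule ccontr)
    assume "u \<notin> w"
    let ?E = "edges T - {{v, w}}"
    have e: "{v, w} \<in> edges T"
      and ys: "successively (\<lambda>a b. {a, b} \<in> edges T) (ys @ [v])"
      and zs: "successively (\<lambda>a b. {a, b} \<in> edges T) (w # zs)"
      using succ unfolding p' by (simp_all add: successively_append_iff)
    have nin: "w \<notin> set (ys @ [v])" "v \<notin> set (w # zs)"
      using ps(3) unfolding p' by auto
    have succ': "successively (\<lambda>a b. {a, b} \<in> ?E) (ys @ [v])"
      by (rule successively_mono[OF ys]) (use nin in \<open>auto simp: doubleton_eq_iff\<close>)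
    have succ'': "successively (\<lambda>a b. {a, b} \<in> ?E) (w # zs)"
      by (rule successively_mono[OF zs]) (use nin in \<open>auto simp: doubleton_eq_iff\<close>)
    have "hd (ys @ [v]) = hd p" unfolding p' by (cases ys) simp_all
    with path_rtrancl[OF succ'] have "(hd p, v) \<in> (adj ?E)\<^sup>*" by simp
    then have vh: "(v, hd p) \<in> (adj ?E)\<^sup>*" by (rule rtrancl_adj_sym)
    have "(w, last p) \<in> (adj ?E)\<^sup>*"
      using path_rtrancl[OF succ''] unfolding p' by simp
    then have lw: "(last p, w) \<in> (adj ?E)\<^sup>*" by (rule rtrancl_adj_sym)
    have "(hd p, last p) \<in> (adj ?E)\<^sup>*"
      by (rule rtrancl_adj_mono[OF hl]) (use \<open>u \<notin> w\<close> in \<open>auto simp: links_def\<close>)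
    from rtrancl_trans[OF rtrancl_trans[OF vh this] lw] have "(v, w) \<in> (adj ?E)\<^sup>*" .
    then show False using tree_edge_cut[OF T e] by simp
  qed
  obtain ys zs where "p = ys @ c # zs" using c by (meson split_list)
  then show "u \<in> c"
    using link[of "butlast ys" "last ys" c zs] u by (cases ys rule: rev_cases) simp_all
qed

text \<open>The Helly property. A node \<open>n\<close> meeting \<open>D\<close> in the most
  vertices must contain \<open>D\<close>: if \<open>u\<close> were missing, walk from
  \<open>n\<close> until \<open>u\<close> first appears, at a node \<open>b\<close>. This
  \<open>b\<close> still contains all of \<open>n \<inter> D\<close> and also \<open>u\<close>,
  contradicting maximality.\<close>

lemma complete_subset_node:
  assumes T: "is_tree T" "junction_property T" and fin: "\<And>c. c \<in> verts T \<Longrightarrow> finite c"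
    and D: "D \<subseteq> \<Union>(verts T)"
      "\<And>u v. u \<in> D \<Longrightarrow> v \<in> D \<Longrightarrow> u \<noteq> v \<Longrightarrow> \<exists>c\<in>verts T. u \<in> c \<and> v \<in> c"
  shows "\<exists>c\<in>verts T. D \<subseteq> c"
proof -
  have G: "ugraph T" "connected_graph T" using T by (auto simp: is_tree_def)
  then have V: "finite (verts T)" "verts T \<noteq> {}" by (auto simp: ugraph_def connected_graph_def)
  have "Max ((\<lambda>c. card (c \<inter> D)) ` verts T) \<in> (\<lambda>c. card (c \<inter> D)) ` verts T"
    using V by (intro Max_in) auto
  then obtain n where n: "n \<in> verts T"
    and max: "Max ((\<lambda>c. card (c \<inter> D)) ` verts T) = card (n \<inter> D)" by (rule imageE)
  have le: "card (c \<inter> D) \<le> card (n \<inter> D)" if "c \<in> verts T" for c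
    unfolding max[symmetric] using V(1) that by (intro Max_ge) auto
  have "D \<subseteq> n"
  proof (rule ccontr)
    assume "\<not> D \<subseteq> n"
    then obtain u where u: "u \<in> D" "u \<notin> n" by blast
    then obtain b0 where b0: "b0 \<in> verts T" "u \<in> b0" using D(1) by blast
    have nb0: "(n, b0) \<in> (adj (edges T))\<^sup>*" using G(2) n b0 by (simp add: connected_graph_iff)
    define S where "S = {c. u \<notin> c}"
    have S: "n \<in> S" "b0 \<notin> S" using u b0 by (simp_all add: S_def)
    obtain w b where nw: "(n, w) \<in> (adj (edges T) \<inter> S \<times> S)\<^sup>*"
      and e: "(w, b) \<in> adj (edges T)" and wb: "w \<in> S" "b \<notin> S"
      by (rule rtrancl_first_exit[OF nb0 S])
    then have wb': "u \<notin> w" "u \<in> b" by (simp_all add: S_def)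
    from e have e: "{w, b} \<in> edges T" by simp
    let ?E = "edges T - {{w, b}}"
    \<comment> \<open>Before the exit all nodes avoid \<open>u\<close>, whereas \<open>b\<close>
      contains it.\<close>
    have "adj (edges T) \<inter> S \<times> S \<subseteq> adj ?E"
      using \<open>b \<notin> S\<close> by (auto simp: doubleton_eq_iff)
    from rtrancl_mono[OF this] nw have nw: "(n, w) \<in> (adj ?E)\<^sup>*" by (rule subsetD)
    have bV: "b \<in> verts T" using ugraph_edge(2)[OF G(1) e] .
    \<comment> \<open>Some node \<open>c\<close> holds both \<open>u\<close> and \<open>v\<close>.
      If \<open>v\<close> were missing from \<open>b\<close>, going from \<open>w\<close> back to
      \<open>n\<close>, on to \<open>c\<close> along nodes with \<open>v\<close>, and to
      \<open>b\<close> along nodes with \<open>u\<close> would bypass the bridge.\<close>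
    have "v \<in> b" if v: "v \<in> n \<inter> D" for v
    proof (rule ccontr)
      assume "v \<notin> b"
      obtain c where c: "c \<in> verts T" "u \<in> c" "v \<in> c" using D(2)[of u v] v u by (metis IntD1 IntD2)
      have "(n, c) \<in> (adj (links T {v}))\<^sup>*"
        by (rule junction_property_links[OF T n c(1)]) (use v c in auto)
      then have nc: "(n, c) \<in> (adj ?E)\<^sup>*"
        by (rule rtrancl_adj_mono) (use \<open>v \<notin> b\<close> in \<open>auto simp: links_def\<close>)
      have "(c, b) \<in> (adj (links T {u}))\<^sup>*"
        by (rule junction_property_links[OF T c(1) bV]) (use wb' c in auto)
      then have cb: "(c, b) \<in> (adj ?E)\<^sup>*"
        by (rule rtrancl_adj_mono) (use wb' in \<open>auto simp: links_def\<close>)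
      from rtrancl_trans[OF rtrancl_trans[OF rtrancl_adj_sym[OF nw] nc] cb]
      have "(w, b) \<in> (adj ?E)\<^sup>*" .
      then show False using tree_edge_cut[OF T(1) e] by contradiction
    qed
    then have "n \<inter> D \<subset> b \<inter> D" using u wb' by auto
    then have "card (n \<inter> D) < card (b \<inter> D)" using fin[OF bV] by (intro psubset_card_mono) auto
    then show False using le[OF bV] by simp
  qed
  with n show ?thesis by blast
qed

section \<open>Junction trees as trees on antichains\<close>

lemma underlying_edge_iff:
  "u \<noteq> v \<Longrightarrow> {u, v} \<in> edges (underlying T) \<longleftrightarrow> (\<exists>c\<in>verts T. u \<in> c \<and> v \<in> c)"
  by (auto simp: underlying_def doubleton_eq_iff)

text \<open>Complete sets are exactly the subsets of nodes, so the cliques are the maximal nodes,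
  and the antichain condition makes every node maximal.\<close>

lemma junction_tree_of_underlying:
  assumes T: "is_tree T" "junction_property T" and fin: "\<And>c. c \<in> verts T \<Longrightarrow> finite c"
    and antichain: "\<And>b c. b \<in> verts T \<Longrightarrow> c \<in> verts T \<Longrightarrow> b \<subseteq> c \<Longrightarrow> b = c"
  shows "ugraph (underlying T)" "junction_tree_of (underlying T) T"
proof -
  have "finite (verts T)" using T by (auto simp: is_tree_def ugraph_def)
  then show "ugraph (underlying T)" using fin by (auto simp: ugraph_def underlying_def)
  define comp where "comp = (\<lambda>C. C \<subseteq> verts (underlying T) \<and>
    (\<forall>u\<in>C. \<forall>v\<in>C. u \<noteq> v \<longrightarrow> {u, v} \<in> edges (underlying T)))"
  have sub: "\<exists>c\<in>verts T. D \<subseteq> c" if "comp D" for D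
  proof -
    from that have "D \<subseteq> \<Union>(verts T)" by (auto simp: comp_def underlying_def)
    moreover have "\<exists>c\<in>verts T. u \<in> c \<and> v \<in> c" if "u \<in> D" "v \<in> D" "u \<noteq> v" for u v
      using \<open>comp D\<close> that by (auto simp: comp_def underlying_edge_iff)
    ultimately show ?thesis
      by (intro complete_subset_node[OF T]) (simp_all add: fin)
  qed
  have comp: "comp c" if "c \<in> verts T" for c
    using that by (auto simp: comp_def underlying_edge_iff underlying_def)
  have "cliques (underlying T) = {C. comp C \<and> (\<forall>D. comp D \<and> C \<subseteq> D \<longrightarrow> D = C)}"
    by (simp add: cliques_def comp_def)
  also have "\<dots> = verts T"
  proof (intro set_eqI iffI)
    fix C assume "C \<in> {C. comp C \<and> (\<forall>D. comp D \<and> C \<subseteq> D \<longrightarrow> D = C)}"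
    then have C: "comp C" "\<forall>D. comp D \<and> C \<subseteq> D \<longrightarrow> D = C" by auto
    from sub[OF C(1)] obtain c where c: "c \<in> verts T" "C \<subseteq> c" ..
    with C(2) comp[OF c(1)] have "c = C" by blast
    with c(1) show "C \<in> verts T" by simp
  next
    fix C assume C: "C \<in> verts T"
    have "D = C" if "comp D" "C \<subseteq> D" for D
      using sub[OF that(1)] that(2) antichain[OF C] by fastforce
    with comp[OF C] show "C \<in> {C. comp C \<and> (\<forall>D. comp D \<and> C \<subseteq> D \<longrightarrow> D = C)}" by blast
  qed
  finally show "junction_tree_of (underlying T) T" using T by (simp add: junction_tree_of_def)
qed

text \<open>The underlying graph serves as the witness, and \<open>T\<close> itself shows that it is
  decomposable.\<close>

lemma junction_treesI:
  assumes "is_tree T" "junction_property T" "\<Union>(verts T) = y ` {1..m}"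
    and "\<And>b c. b \<in> verts T \<Longrightarrow> c \<in> verts T \<Longrightarrow> b \<subseteq> c \<Longrightarrow> b = c"
  shows "T \<in> junction_trees y m"
proof -
  have "finite c" if "c \<in> verts T" for c
    using assms(3) that finite_subset[of c "y ` {1..m}"] by blast
  note * = junction_tree_of_underlying[OF assms(1,2) this assms(4)]
  have "verts (underlying T) = y ` {1..m}" using assms(3) by (simp add: underlying_def)
  with * show ?thesis unfolding junction_trees_def decomposable_def by blast
qed

text \<open>Finiteness extends each single vertex to a clique. The empty set can be a clique only if
  it is the only one; excluding it later keeps the singleton of the new vertex incomparable to the
  old nodes.\<close>

lemma cliques_props:
  assumes G: "finite (verts G)"
  shows "\<Union>(cliques G) = verts G"
    and "b \<in> cliques G \<Longrightarrow> c \<in> cliques G \<Longrightarrow> b \<subseteq> c \<Longrightarrow> b = c"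
    and "verts G \<noteq> {} \<Longrightarrow> {} \<notin> cliques G"
proof -
  define comp where "comp = (\<lambda>C. C \<subseteq> verts G \<and> (\<forall>u\<in>C. \<forall>v\<in>C. u \<noteq> v \<longrightarrow> {u, v} \<in> edges G))"
  have cl: "cliques G = {C. comp C \<and> (\<forall>D. comp D \<and> C \<subseteq> D \<longrightarrow> D = C)}"
    by (simp add: cliques_def comp_def)
  then show "b \<in> cliques G \<Longrightarrow> c \<in> cliques G \<Longrightarrow> b \<subseteq> c \<Longrightarrow> b = c" by blast
  have fin: "finite {C. comp C}"
    by (rule finite_subset[of _ "Pow (verts G)"]) (use G in \<open>auto simp: comp_def\<close>)
  have ex: "\<exists>C\<in>cliques G. v \<in> C" if "v \<in> verts G" for v
  proof -
    from that have "comp {v}" by (auto simp: comp_def)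
    then obtain C where "comp C" "{v} \<subseteq> C" "\<forall>D. comp D \<and> C \<subseteq> D \<longrightarrow> D = C"
      using finite_has_maximal2[OF fin, of "{v}"] by auto
    then show ?thesis unfolding cl by blast
  qed
  then show U: "\<Union>(cliques G) = verts G" by (auto simp: cl comp_def)
  show "{} \<notin> cliques G" if ne: "verts G \<noteq> {}"
  proof
    assume "{} \<in> cliques G"
    then have "C = {}" if "C \<in> cliques G" for C using that unfolding cl by blast
    then show False using U ne by auto
  qed
qed

lemma junction_treesD:
  assumes "T \<in> junction_trees y m" "m \<ge> 1"
  shows "is_tree T" "junction_property T" "\<Union>(verts T) = y ` {1..m}"
    and "b \<in> verts T \<Longrightarrow> c \<in> verts T \<Longrightarrow> b \<subseteq> c \<Longrightarrow> b = c" and "{} \<notin> verts T"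
proof -
  from assms(1) obtain G where G: "ugraph G" "verts G = y ` {1..m}"
    and T: "is_tree T" "verts T = cliques G" "junction_property T"
    by (auto simp: junction_trees_def decomposable_def junction_tree_of_def)
  then show "is_tree T" "junction_property T" by auto
  have f: "finite (verts G)" "verts G \<noteq> {}" using G assms(2) by auto
  show "\<Union>(verts T) = y ` {1..m}"
    "b \<in> verts T \<Longrightarrow> c \<in> verts T \<Longrightarrow> b \<subseteq> c \<Longrightarrow> b = c" "{} \<notin> verts T"
    using cliques_props[OF f(1)] f(2) G(2) T(2) by auto
qed

section \<open>Old vertices in an extended tree\<close>

lemma induced_underlying_edges:
  "edges (induced (underlying R) W) =
     {{u, v} | u v. u \<noteq> v \<and> (\<exists>p\<in>verts R. u \<in> p \<and> v \<in> p) \<and> u \<in> W \<and> v \<in> W}" (is "?l = ?r")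
proof (intro subset_antisym subsetI)
  fix e assume "e \<in> ?l"
  then obtain u v p where "e = {u, v}" "u \<noteq> v" "p \<in> verts R" "u \<in> p" "v \<in> p" "{u, v} \<subseteq> W"
    by (auto simp: induced_def underlying_def)
  then show "e \<in> ?r" by blast
next
  fix e assume "e \<in> ?r"
  then obtain u v p where "e = {u, v}" "u \<noteq> v" "p \<in> verts R" "u \<in> p" "v \<in> p" "{u, v} \<subseteq> W"
    by blast
  then show "e \<in> ?l" by (auto simp: induced_def underlying_def)
qed

text \<open>\<open>down\<close> rules out new adjacencies between old vertices and \<open>up\<close>
  keeps the old ones, so preservation of the old graph reduces to comparing nodes.\<close>

lemma underlying_extension:
  assumes "x \<notin> \<Union>(verts T)"
    and down: "\<And>p. p \<in> verts R \<Longrightarrow> \<exists>c\<in>verts T. p - {x} \<subseteq> c"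
    and up: "\<And>c. c \<in> verts T \<Longrightarrow> \<exists>p\<in>verts R. c \<subseteq> p"
  shows "\<Union>(verts R) - {x} = \<Union>(verts T)"
    and "induced (underlying R) (\<Union>(verts T)) = underlying T"
proof -
  show V: "\<Union>(verts R) - {x} = \<Union>(verts T)"
  proof
    show "\<Union>(verts R) - {x} \<subseteq> \<Union>(verts T)"
    proof
      fix u assume "u \<in> \<Union>(verts R) - {x}"
      then obtain p where p: "p \<in> verts R" "u \<in> p - {x}" by blast
      with down[OF p(1)] show "u \<in> \<Union>(verts T)" by blast
    qed
    show "\<Union>(verts T) \<subseteq> \<Union>(verts R) - {x}"
    proof
      fix u assume u: "u \<in> \<Union>(verts T)"
      then obtain c where c: "c \<in> verts T" "u \<in> c" by blast
      from up[OF c(1)] c(2) u assms(1) show "u \<in> \<Union>(verts R) - {x}" by blast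
    qed
  qed
  have iff: "(\<exists>p\<in>verts R. u \<in> p \<and> v \<in> p) \<and> u \<in> \<Union>(verts T) \<and> v \<in> \<Union>(verts T) \<longleftrightarrow>
      (\<exists>c\<in>verts T. u \<in> c \<and> v \<in> c)" (is "?l \<longleftrightarrow> ?r") for u v
  proof
    assume ?l
    then obtain p where p: "p \<in> verts R" "u \<in> p - {x}" "v \<in> p - {x}" using assms(1) by blast
    with down[OF p(1)] show ?r by blast
  next
    assume ?r
    then obtain c where c: "c \<in> verts T" "u \<in> c" "v \<in> c" by blast
    with up[OF c(1)] show ?l by blast
  qed
  have "edges (induced (underlying R) (\<Union>(verts T))) = edges (underlying T)"
    unfolding induced_underlying_edges iff by (simp add: underlying_def)
  moreover have "verts (induced (underlying R) (\<Union>(verts T))) = verts (underlying T)"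
    using V by (auto simp: induced_def underlying_def)
  ultimately show "induced (underlying R) (\<Union>(verts T)) = underlying T"
    by (rule prod_eqI[rotated])
qed

section \<open>Expansion along a nonempty subtree\<close>

text \<open>Isolates what every draw guarantees, so that the rest is free of probability.
  \<open>moved\<close> covers both the forced transfer of neighbours from a deleted node and the
  random choice at a surviving one.\<close>

locale expansion =
  fixes x :: 'a and T T' :: "'a set ugraph"
    and d :: "'a set \<Rightarrow> 'a set" and moved :: "'a set \<Rightarrow> 'a set set"
  assumes tree: "is_tree T" and junction: "junction_property T"
    and antichain: "\<And>b c. b \<in> verts T \<Longrightarrow> c \<in> verts T \<Longrightarrow> b \<subseteq> c \<Longrightarrow> b = c"
    and fresh: "x \<notin> \<Union>(verts T)"
    and subtree: "T' \<in> subtrees T" and nonempty: "verts T' \<noteq> {}"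
    and d_subset: "\<And>c. c \<in> verts T' \<Longrightarrow> d c \<subseteq> c"
    and separator_subset_d: "\<And>b c. {c, b} \<in> edges T' \<Longrightarrow> c \<inter> b \<subseteq> d c"
    and d_antichain: "\<And>b c. b \<in> verts T' \<Longrightarrow> c \<in> verts T' \<Longrightarrow> d b \<subseteq> d c \<Longrightarrow> b = c"
    and moved: "\<And>b c. c \<in> verts T' \<Longrightarrow> b \<in> moved c \<Longrightarrow> {c, b} \<in> edges T \<and> b \<notin> verts T' \<and> b \<inter> c \<subseteq> d c"
    and moved_all: "\<And>b c. c \<in> verts T' \<Longrightarrow> d c = c \<Longrightarrow> {c, b} \<in> edges T \<Longrightarrow> b \<notin> verts T' \<Longrightarrow> b \<in> moved c"
begin

definition plus :: "'a set \<Rightarrow> 'a set" where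
  "plus c = insert x (d c)"

text \<open>Copies the shape of \<open>rebuild\<close> literally, so that the two agree by
  unfolding.\<close>

definition R :: "'a set ugraph" where
  "R = ((verts T - {c \<in> verts T'. d c = c}) \<union> plus ` verts T',
     (edges T - edges T' - {{c, b} | c b. c \<in> verts T' \<and> b \<in> moved c})
     \<union> {{plus c, plus b} | c b. {c, b} \<in> edges T'}
     \<union> {{c, plus c} | c. c \<in> verts T' \<and> d c \<noteq> c}
     \<union> {{plus c, b} | c b. c \<in> verts T' \<and> b \<in> moved c})"

section \<open>Nodes and links of the output\<close>

lemma verts_R: "verts R = (verts T - {c \<in> verts T'. d c = c}) \<union> plus ` verts T'"
  by (simp add: R_def)

lemma within: "{c, b} \<in> edges T' \<Longrightarrow> {plus c, plus b} \<in> edges R"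
  unfolding R_def snd_conv
  by (rule UnI1, rule UnI1, rule UnI2, rule CollectI, rule exI[of _ c], rule exI[of _ b]) simp

lemma twin: "c \<in> verts T' \<Longrightarrow> d c \<noteq> c \<Longrightarrow> {c, plus c} \<in> edges R"
  unfolding R_def snd_conv
  by (rule UnI1, rule UnI2, rule CollectI, rule exI[of _ c]) simp

lemma passed: "c \<in> verts T' \<Longrightarrow> b \<in> moved c \<Longrightarrow> {plus c, b} \<in> edges R"
  unfolding R_def snd_conv
  by (rule UnI2, rule CollectI, rule exI[of _ c], rule exI[of _ b]) simp

lemma ugraphs: "ugraph T" "ugraph T'"
  and sub: "verts T' \<subseteq> verts T" "edges T' \<subseteq> edges T"
  and connected_T': "connected_graph T'"
  using tree subtree nonempty by (auto simp: is_tree_def subtrees_def)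

lemma fresh_node: "c \<in> verts T \<Longrightarrow> x \<notin> c"
  using fresh by blast

lemma fresh_d: "c \<in> verts T' \<Longrightarrow> x \<notin> d c"
  using fresh_node d_subset sub(1) by blast

lemma plus_eq_iff: "b \<in> verts T' \<Longrightarrow> c \<in> verts T' \<Longrightarrow> plus b = plus c \<longleftrightarrow> b = c"
  using d_antichain fresh_d unfolding plus_def by (metis insert_ident order_refl)

lemma plus_notin: "plus c \<notin> verts T"
  using fresh_node by (auto simp: plus_def)

text \<open>Links are unordered pairs, so a kept link has to avoid the moved pairs in both
  orientations.\<close>

lemma edges_R_cases [consumes 1, case_names kept within twin passed]:
  assumes "e \<in> edges R"
  obtains
    (kept) a b where "e = {a, b}" "{a, b} \<in> edges T" "{a, b} \<notin> edges T'"
      "a \<in> verts T' \<Longrightarrow> b \<notin> moved a" "b \<in> verts T' \<Longrightarrow> a \<notin> moved b"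
  | (within) b c where "e = {plus c, plus b}" "{c, b} \<in> edges T'"
  | (twin) c where "e = {c, plus c}" "c \<in> verts T'" "d c \<noteq> c"
  | (passed) b c where "e = {plus c, b}" "c \<in> verts T'" "b \<in> moved c"
proof -
  from assms have "e \<in> edges T \<and> e \<notin> edges T' \<and> (\<nexists>c b. e = {c, b} \<and> c \<in> verts T' \<and> b \<in> moved c)
    \<or> (\<exists>c b. e = {plus c, plus b} \<and> {c, b} \<in> edges T')
    \<or> (\<exists>c. e = {c, plus c} \<and> c \<in> verts T' \<and> d c \<noteq> c)
    \<or> (\<exists>c b. e = {plus c, b} \<and> c \<in> verts T' \<and> b \<in> moved c)"
    by (simp only: R_def snd_conv Un_iff Diff_iff mem_Collect_eq conj_assoc disj_assoc simp_thms)
  then show ?thesis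
  proof (elim disjE exE conjE)
    assume e: "e \<in> edges T" "e \<notin> edges T'" "\<nexists>c b. e = {c, b} \<and> c \<in> verts T' \<and> b \<in> moved c"
    obtain a b where ab: "e = {a, b}" by (rule ugraph_edgeE[OF ugraphs(1) e(1)])
    then have ba: "e = {b, a}" by (simp only: insert_commute)
    have "{a, b} \<in> edges T" "{a, b} \<notin> edges T'" using e(1,2) unfolding ab .
    moreover have "b \<notin> moved a" if "a \<in> verts T'" using e(3) ab that by blast
    moreover have "a \<notin> moved b" if "b \<in> verts T'" using e(3) ba that by blast
    ultimately show ?thesis by (rule kept[OF ab])
  qed (fact within twin passed)+
qed

text \<open>A deleted node hands over all its links leaving the subtree, and its links inside the
  subtree are replaced, so no kept link ends in it.\<close>

lemma kept_verts:
  assumes "{a, b} \<in> edges T" "{a, b} \<notin> edges T'" "a \<in> verts T' \<Longrightarrow> b \<notin> moved a"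
  shows "a \<in> verts R"
proof -
  note ab = ugraph_edge[OF ugraphs(1) assms(1)]
  have "d a \<noteq> a" if a: "a \<in> verts T'"
  proof
    assume "d a = a"
    with moved_all[OF a this assms(1)] assms(3)[OF a] have "b \<in> verts T'" by blast
    with subtree_induced_edge[OF tree subtree assms(1) a] assms(2) show False by blast
  qed
  with ab show ?thesis by (auto simp: verts_R)
qed

lemma ugraph_R: "ugraph R"
proof -
  have "finite (verts R)"
    using ugraphs by (auto simp: verts_R ugraph_def)
  moreover have "e \<subseteq> verts R \<and> card e = 2" if "e \<in> edges R" for e
    using that
  proof (cases rule: edges_R_cases)
    case (kept a b)
    have "{b, a} = {a, b}" by (rule insert_commute)
    with kept(2,3) have ba: "{b, a} \<in> edges T" "{b, a} \<notin> edges T'" by simp_all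
    have "a \<in> verts R" using kept(4) by (rule kept_verts[OF kept(2,3)])
    moreover have "b \<in> verts R" using kept(5) by (rule kept_verts[OF ba])
    moreover note kept(1) ugraph_edge(3)[OF ugraphs(1) kept(2)]
    ultimately show ?thesis by simp
  next
    case (within b c)
    note cb = ugraph_edge[OF ugraphs(2) within(2)]
    with plus_eq_iff[of c b] within(1) show ?thesis by (simp add: verts_R)
  next
    case (twin c)
    then have "c \<in> verts T" using sub by blast
    moreover from this have "plus c \<noteq> c" using plus_notin by metis
    ultimately show ?thesis using twin by (simp add: verts_R)
  next
    case (passed b c)
    note m = moved[OF passed(2,3)]
    then have "b \<in> verts T" using ugraph_edge(2)[OF ugraphs(1), of c b] by blast
    moreover from this have "plus c \<noteq> b" using plus_notin by metis
    ultimately show ?thesis using m passed(1,2) by (simp add: verts_R)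
  qed
  ultimately show ?thesis by (auto simp: ugraph_def)
qed

text \<open>The fibre above \<open>c\<close> of the contraction from \<open>R\<close> to
  \<open>T\<close>: the original if it survives, and its copy if there is one.\<close>

definition over :: "'a set \<Rightarrow> 'a set set" where
  "over c = {p \<in> verts R. p = c \<or> c \<in> verts T' \<and> p = plus c}"

lemma over_linked:
  assumes c: "c \<in> verts T" and p: "p \<in> over c" "U \<subseteq> p" and q: "q \<in> over c" "U \<subseteq> q"
  shows "(p, q) \<in> (adj (links R U))\<^sup>*"
proof (cases "p = q")
  case False
  then have c': "c \<in> verts T'" "c \<in> verts R" and pq: "{p, q} = {c, plus c}"
    using p(1) q(1) by (auto simp: over_def)
  \<comment> \<open>\<open>c\<close> is itself a node of \<open>R\<close> and not a copy, so it was
    not deleted.\<close>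
  have "d c \<noteq> c" using c c' plus_notin by (auto simp: verts_R)
  then have "{p, q} \<in> edges R" unfolding pq using c'(1) by (simp add: twin)
  then have "(p, q) \<in> adj (links R U)" using p q by simp
  then show ?thesis by blast
qed simp

text \<open>A link of \<open>T\<close> is inside \<open>T'\<close>, moved from one of its ends, or
  kept. In the first two situations the separator lies in \<open>d\<close> of every end that is
  replaced by its copy, so \<open>U\<close> survives.\<close>

lemma lift_edge:
  assumes e: "{b, c} \<in> edges T" and U: "U \<subseteq> b" "U \<subseteq> c"
  obtains p q where "p \<in> over b" "q \<in> over c" "{p, q} \<in> links R U"
proof -
  note witness = that
  \<comment> \<open>Membership in the fibres comes for free, since the ends of a link of
    \<open>R\<close> are nodes of \<open>R\<close>.\<close>
  have lift: thesis if e: "{p, q} \<in> edges R" and "p = b \<or> b \<in> verts T' \<and> p = plus b"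
    "q = c \<or> c \<in> verts T' \<and> q = plus c" "U \<subseteq> p" "U \<subseteq> q" for p q
  proof (rule witness)
    show "p \<in> over b" "q \<in> over c"
      using ugraph_edge(1,2)[OF ugraph_R e] \<open>p = b \<or> _\<close> \<open>q = c \<or> _\<close> by (simp_all add: over_def)
    show "{p, q} \<in> links R U" using that by simp
  qed
  have cb: "{c, b} = {b, c}" by (rule insert_commute)
  consider "{b, c} \<in> edges T'" | "b \<in> verts T'" "c \<in> moved b" | "c \<in> verts T'" "b \<in> moved c"
    | "{b, c} \<notin> edges T'" "\<not> (b \<in> verts T' \<and> c \<in> moved b)" "\<not> (c \<in> verts T' \<and> b \<in> moved c)"
    by blast
  then show thesis
  proof cases
    case 1
    with cb have 1: "{b, c} \<in> edges T'" "{c, b} \<in> edges T'" by simp_all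
    have "{plus b, plus c} \<in> edges R" using 1(1) by (rule within)
    moreover have "U \<subseteq> plus b" "U \<subseteq> plus c"
      using separator_subset_d[OF 1(1)] separator_subset_d[OF 1(2)] U unfolding plus_def by blast+
    ultimately show ?thesis using ugraph_edge(1,2)[OF ugraphs(2) 1(1)] by (intro lift[of "plus b" "plus c"]) simp_all
  next
    case 2
    have "{plus b, c} \<in> edges R" using 2 by (rule passed)
    moreover have "U \<subseteq> plus b" using moved[OF 2] U unfolding plus_def by blast
    ultimately show ?thesis using 2 U by (intro lift[of "plus b" c]) simp_all
  next
    case 3
    have "{plus c, b} \<in> edges R" using 3 by (rule passed)
    then have "{b, plus c} \<in> edges R" by (subst insert_commute)
    moreover have "U \<subseteq> plus c" using moved[OF 3] U unfolding plus_def by blast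
    ultimately show ?thesis using 3 U by (intro lift[of b "plus c"]) simp_all
  next
    case 4
    then have "{b, c} \<notin> {{c, b} | c b. c \<in> verts T' \<and> b \<in> moved c}"
      unfolding mem_Collect_eq doubleton_eq_iff by blast
    with 4(1) e have "{b, c} \<in> edges R" by (simp add: R_def)
    then show ?thesis using U by (intro lift[of b c]) simp_all
  qed
qed

text \<open>Each step moves within a fibre to the end of a lifted link and crosses it. The endpoint
  \<open>q\<close> is generalised because lifts of consecutive links may meet a fibre in different
  nodes.\<close>

lemma lift_walk:
  assumes "(a, b) \<in> (adj (links T U))\<^sup>*" "a \<in> verts T"
    and p: "p \<in> over a" "U \<subseteq> p" and q: "q \<in> over b" "U \<subseteq> q"
  shows "(p, q) \<in> (adj (links R U))\<^sup>*"
  using assms(1) q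
proof (induction arbitrary: q rule: rtrancl_induct)
  case base
  then show ?case using over_linked[OF assms(2) p] by blast
next
  case (step b c)
  then have e: "{b, c} \<in> edges T" "U \<subseteq> b" "U \<subseteq> c" by auto
  obtain p' q' where pq: "p' \<in> over b" "q' \<in> over c" "{p', q'} \<in> links R U"
    by (rule lift_edge[OF e])
  then have "(p, p') \<in> (adj (links R U))\<^sup>*" using step.IH by simp
  also have "(p', q') \<in> adj (links R U)" using pq by simp
  also have "(q', q) \<in> (adj (links R U))\<^sup>*"
    using over_linked[OF ugraph_edge(2)[OF ugraphs(1) e(1)] pq(2) _ step.prems] pq(3) by simp
  finally show ?case .
qed

lemma below:
  assumes "p \<in> verts R"
  obtains c where "c \<in> verts T" "p \<in> over c" "p - {x} \<subseteq> c"
proof (cases "p \<in> verts T")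
  case True
  with assms show ?thesis using that[of p] by (auto simp: over_def)
next
  case False
  with assms obtain c where "c \<in> verts T'" "p = plus c" by (auto simp: verts_R)
  with assms sub d_subset[of c] show ?thesis
    using that[of c] by (auto simp: over_def plus_def)
qed

text \<open>As \<open>x\<close> is not in \<open>U\<close>, projecting the two nodes to
  \<open>T\<close> keeps \<open>U\<close>; the walk found there is lifted back.\<close>

lemma links_connected_old:
  assumes "x \<notin> U" "p \<in> verts R" "q \<in> verts R" "U \<subseteq> p" "U \<subseteq> q"
  shows "(p, q) \<in> (adj (links R U))\<^sup>*"
proof -
  obtain a where a: "a \<in> verts T" "p \<in> over a" "p - {x} \<subseteq> a" by (rule below[OF assms(2)])
  obtain b where b: "b \<in> verts T" "q \<in> over b" "q - {x} \<subseteq> b" by (rule below[OF assms(3)])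
  have "U \<subseteq> a" "U \<subseteq> b" using assms a b by blast+
  from junction_property_links[OF tree junction a(1) b(1) this]
  show ?thesis by (rule lift_walk[OF _ a(1,2) assms(4) b(2) assms(5)])
qed

text \<open>Only copies contain \<open>x\<close>, and the links between copies reproduce the
  connected \<open>T'\<close>.\<close>

lemma links_connected_new:
  assumes "p \<in> verts R" "q \<in> verts R" "x \<in> p" "x \<in> q"
  shows "(p, q) \<in> (adj (links R {x}))\<^sup>*"
proof -
  from assms obtain a b where ab: "a \<in> verts T'" "b \<in> verts T'" "p = plus a" "q = plus b"
    using fresh_node by (auto simp: verts_R)
  with connected_T' have "(a, b) \<in> (adj (edges T'))\<^sup>*" by (simp add: connected_graph_iff)
  then have "(plus a, plus b) \<in> (adj (links R {x}))\<^sup>*"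
  proof (induction rule: rtrancl_induct)
    case (step b c)
    then have "{plus b, plus c} \<in> edges R" by (simp add: within)
    then have "(plus b, plus c) \<in> adj (links R {x})" by (simp add: plus_def)
    with step.IH show ?case by (rule rtrancl_into_rtrancl)
  qed simp
  with ab show ?thesis by simp
qed

lemma connected_R: "connected_graph R"
proof -
  have "verts R \<noteq> {}" using nonempty by (auto simp: verts_R)
  moreover have "links R {} = edges R" by (simp add: links_def)
  ultimately show ?thesis
    using links_connected_old[of "{}"] by (simp add: connected_graph_iff)
qed

text \<open>A deleted node is balanced by its copy, so only surviving nodes of the subtree
  contribute an extra node.\<close>

lemma card_verts_R: "card (verts R) = card (verts T) + card {c \<in> verts T'. d c \<noteq> c}"
proof -
  let ?A = "{c \<in> verts T'. d c = c}" and ?N = "{c \<in> verts T'. d c \<noteq> c}"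
  have fin: "finite (verts T)" "finite (verts T')" using ugraphs by (auto simp: ugraph_def)
  have A: "?A \<subseteq> verts T" using sub by blast
  have "card (verts T') = card (?A \<union> ?N)" by (rule arg_cong[of _ _ card]) blast
  also have "\<dots> = card ?A + card ?N" using fin by (intro card_Un_disjoint) auto
  finally have T': "card (verts T') = card ?A + card ?N" .
  have "card (verts R) = card (verts T - ?A) + card (plus ` verts T')"
    unfolding verts_R using fin plus_notin by (intro card_Un_disjoint) auto
  also have "card (plus ` verts T') = card (verts T')"
    by (intro card_image inj_onI) (simp add: plus_eq_iff)
  also have "card (verts T - ?A) = card (verts T) - card ?A"
    using A fin by (intro card_Diff_subset) auto
  finally show ?thesis using T' card_mono[OF fin(1) A] by simp
qed

text \<open>Every link of \<open>T\<close> contributes one link to \<open>R\<close>, and the only others join a node to its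
  expanded copy.\<close>

lemma card_edges_R: "card (edges R) \<le> card (edges T) + card {c \<in> verts T'. d c \<noteq> c}"
proof -
  let ?N = "{c \<in> verts T'. d c \<noteq> c}"
  \<comment> \<open>An end is replaced by its copy exactly when the link lies in \<open>T'\<close>
    or that end passes the link on.\<close>
  define lift where "lift = (\<lambda>e. (\<lambda>v. if v \<in> verts T' \<and> (e \<in> edges T' \<or> (\<exists>b\<in>moved v. e = {v, b}))
    then plus v else v) ` e)"
  have "edges R \<subseteq> lift ` edges T \<union> (\<lambda>c. {c, plus c}) ` ?N"
  proof
    fix e assume "e \<in> edges R"
    then show "e \<in> lift ` edges T \<union> (\<lambda>c. {c, plus c}) ` ?N"
    proof (cases rule: edges_R_cases)
      case (kept a b)
      have fixed: "\<not> (v \<in> verts T' \<and> (e \<in> edges T' \<or> (\<exists>b\<in>moved v. e = {v, b})))" if "v \<in> e" for v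
      proof -
        from that kept(1) have "v = a \<or> v = b" by simp
        then show ?thesis
          using kept(3-5) unfolding kept(1) doubleton_eq_iff by metis
      qed
      have "lift e = (\<lambda>v. v) ` e" unfolding lift_def by (intro image_cong refl if_not_P fixed)
      then have "lift e = e" by simp
      then show ?thesis using kept(1,2) by (intro UnI1 image_eqI[of _ _ e]) simp_all
    next
      case (within b c)
      then have "e = lift {c, b}"
        using ugraph_edge[OF ugraphs(2) within(2)] by (simp add: lift_def)
      then show ?thesis using within(2) sub by (intro UnI1 image_eqI[of _ _ "{c, b}"]) blast+
    next
      case (twin c)
      then show ?thesis by (intro UnI2 image_eqI[of _ _ c]) simp_all
    next
      case (passed b c)
      note m = moved[OF passed(2,3)]
      have "\<exists>b'\<in>moved c. {c, b} = {c, b'}" using passed(3) by (rule bexI[rotated]) (rule refl)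
      with m passed(1,2) have "e = lift {c, b}"
        unfolding lift_def image_insert image_empty by simp
      with m show ?thesis by (intro UnI1 image_eqI[of _ _ "{c, b}"]) simp_all
    qed
  qed
  moreover have fin: "finite (edges T)" "finite ?N"
    using ugraph_finite_edges[OF ugraphs(1)] ugraphs(2) by (simp_all add: ugraph_def)
  ultimately have "card (edges R) \<le> card (lift ` edges T \<union> (\<lambda>c. {c, plus c}) ` ?N)"
    by (intro card_mono) simp_all
  also have "\<dots> \<le> card (lift ` edges T) + card ((\<lambda>c. {c, plus c}) ` ?N)"
    by (rule card_Un_le)
  also have "\<dots> \<le> card (edges T) + card ?N"
    using fin by (intro add_mono card_image_le)
  finally show ?thesis .
qed

text \<open>Passing from \<open>T\<close> to \<open>R\<close> adds at most as many links as nodes,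
  so the edge count of a tree carries over as the bound needed for the connected
  \<open>R\<close>.\<close>

lemma tree_R: "is_tree R"
  using tree_if_card_edges[OF ugraph_R connected_R] card_edges_R card_verts_R tree_card_edges[OF tree]
  by simp

lemma junction_property_R: "junction_property R"
proof (rule junction_propertyI[OF tree_R])
  fix u a b assume "a \<in> verts R" "b \<in> verts R" "u \<in> a" "u \<in> b"
  then show "(a, b) \<in> (adj (links R {u}))\<^sup>*"
    using links_connected_old[of "{u}"] links_connected_new by (cases "u = x") auto
qed

text \<open>An old node inside the copy of \<open>a\<close> satisfies
  \<open>b \<subseteq> d a \<subseteq> a\<close>, hence equals \<open>a\<close> and
  \<open>d a\<close>, but then it was deleted. A copy is never inside an old node because of
  \<open>x\<close>, and two copies compare as their \<open>d\<close> do.\<close>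

lemma antichain_R:
  assumes "b \<in> verts R" "c \<in> verts R" "b \<subseteq> c"
  shows "b = c"
proof -
  have old_new: False if b: "b \<in> verts T" "b \<notin> {c \<in> verts T'. d c = c}"
    and a: "a \<in> verts T'" "b \<subseteq> plus a" for a b
  proof -
    have "b \<subseteq> d a" using a fresh_node[OF b(1)] by (auto simp: plus_def)
    with d_subset[OF a(1)] have "b = a" using antichain[OF b(1)] sub a(1) by blast
    with \<open>b \<subseteq> d a\<close> d_subset[OF a(1)] a b show False by blast
  qed
  have new_new: "b' = c'" if "b' \<in> verts T'" "c' \<in> verts T'" "plus b' \<subseteq> plus c'" for b' c'
    using that fresh_d[of b'] by (intro d_antichain) (auto simp: plus_def)
  have new_old: "\<not> plus a \<subseteq> c" if "c \<in> verts T" for a c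
    using fresh_node[OF that] by (auto simp: plus_def)
  from assms(1,2) show ?thesis
    unfolding verts_R
  proof (elim UnE imageE)
    assume "b \<in> verts T - {c \<in> verts T'. d c = c}" "c \<in> verts T - {c \<in> verts T'. d c = c}"
    with assms(3) show ?thesis by (intro antichain) simp_all
  next
    fix a assume "b \<in> verts T - {c \<in> verts T'. d c = c}" "c = plus a" "a \<in> verts T'"
    with assms(3) old_new[of b a] show ?thesis by simp
  next
    fix a assume "b = plus a" "c \<in> verts T - {c \<in> verts T'. d c = c}"
    with assms(3) new_old[of c a] show ?thesis by simp
  next
    fix b' c' assume "b = plus b'" "c = plus c'" "b' \<in> verts T'" "c' \<in> verts T'"
    with assms(3) new_new[of b' c'] show ?thesis by simp
  qed
qed

lemma above:
  assumes "c \<in> verts T"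
  shows "\<exists>p\<in>verts R. c \<subseteq> p"
proof (cases "c \<in> verts T' \<and> d c = c")
  case True
  then show ?thesis by (intro bexI[of _ "plus c"]) (auto simp: plus_def verts_R)
next
  case False
  with assms show ?thesis by (intro bexI[of _ c]) (auto simp: verts_R)
qed

lemma fresh_covered: "x \<in> \<Union>(verts R)"
  using nonempty by (auto simp: verts_R plus_def)

end

section \<open>Draws of positive probability\<close>

lemma set_Pi_pmf_component:
  "finite A \<Longrightarrow> f \<in> set_pmf (Pi_pmf A z p) \<Longrightarrow> a \<in> A \<Longrightarrow> f a \<in> set_pmf (p a)"
  by (simp add: set_Pi_pmf PiE_dflt_def)

text \<open>Reads the locale assumptions off the supports of the draws. Turning
  \<open>pmf_of_set\<close> into membership requires finite nonempty choice sets, which is checked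
  first.\<close>

lemma expand_nonempty_expansion:
  assumes T: "is_tree T" "junction_property T"
    and antichain: "\<And>b c. b \<in> verts T \<Longrightarrow> c \<in> verts T \<Longrightarrow> b \<subseteq> c \<Longrightarrow> b = c"
    and fresh: "x \<notin> \<Union>(verts T)" and fin: "\<And>c. c \<in> verts T \<Longrightarrow> finite c"
    and T': "T' \<in> subtrees T" "T' \<noteq> ({}, {})"
    and out: "Tp \<in> set_pmf (expand_nonempty x T T')"
  obtains d moved where "expansion x T T' d moved" "Tp = expansion.R x T T' d moved"
proof -
  have G: "ugraph T" "ugraph T'" and sub: "verts T' \<subseteq> verts T" "edges T' \<subseteq> edges T"
    and con: "connected_graph T'"
    using T(1) T' by (auto simp: is_tree_def subtrees_def)
  have finV: "finite (verts T)" "finite (verts T')" using G by (auto simp: ugraph_def)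
  have set_q: "set_pmf (pmf_of_set (q_choices T' c)) = q_choices T' c" if c: "c \<in> verts T'" for c
  proof (rule set_pmf_of_set)
    show "finite (q_choices T' c)" using fin[of c] sub c by (auto simp: q_choices_def)
    \<comment> \<open>Equality would put \<open>c\<close> inside its neighbour, against the
      antichain; so when \<open>q\<close> must be nonempty there is something to choose
      from.\<close>
    have ne: "c \<inter> b \<noteq> c" if "b \<in> nbrs T' c" for b
    proof
      assume eq: "c \<inter> b = c"
      from that have "{c, b} \<in> edges T'" by (simp add: nbrs_def)
      note e = ugraph_edge[OF G(2) this]
      have "c = b" using sub e eq by (intro antichain) auto
      with e(3) show False by simp
    qed
    show "q_choices T' c \<noteq> {}"
    proof (cases "\<exists>b\<in>nbrs T' c. sep_union T' c = c \<inter> b")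
      case True
      then have "c - sep_union T' c \<noteq> {}" using ne by blast
      then have "c - sep_union T' c \<in> q_choices T' c" using True by (simp add: q_choices_def)
      then show ?thesis by blast
    next
      case False
      then show ?thesis by (simp only: q_choices_def if_False Pow_not_empty not_False_eq_True)
    qed
  qed
  have "finite (nbrs T c)" for c
    by (rule finite_subset[OF _ finV(1)]) (use ugraph_edge[OF G(1)] in \<open>auto simp: nbrs_def\<close>)
  then have set_n: "set_pmf (pmf_of_set (n_choices T T' d c)) = n_choices T T' d c" for d c
    unfolding n_choices_def by (intro set_pmf_of_set Pow_not_empty) simp
  from out obtain q n
    where "q \<in> set_pmf (Pi_pmf (verts T') {} (\<lambda>c. pmf_of_set (q_choices T' c)))"
    and "n \<in> set_pmf (Pi_pmf {c \<in> verts T'. sep_union T' c \<union> q c \<noteq> c} {}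
      (\<lambda>c. pmf_of_set (n_choices T T' (\<lambda>c. sep_union T' c \<union> q c) c)))"
    and Tp: "Tp = rebuild x T T' (\<lambda>c. sep_union T' c \<union> q c) n"
    unfolding expand_nonempty_def Let_def set_bind_pmf set_return_pmf by blast
  note qn = this
  have q: "q c \<in> q_choices T' c" if "c \<in> verts T'" for c
    using set_Pi_pmf_component[OF finV(2) qn(1) that] set_q[OF that] by simp
  have n: "n c \<in> n_choices T T' (\<lambda>c. sep_union T' c \<union> q c) c"
    if "c \<in> verts T'" "sep_union T' c \<union> q c \<noteq> c" for c
    using set_Pi_pmf_component[OF _ qn(2), of c] finV(2) that set_n by simp
  define d where "d = (\<lambda>c. sep_union T' c \<union> q c)"
  define moved where "moved = (\<lambda>c. if d c = c then nbrs T c - verts T' else n c)"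
  have q_sub: "q c \<subseteq> c - sep_union T' c" if "c \<in> verts T'" for c
    using q[OF that] by (auto simp: q_choices_def split: if_splits)
  have exp: "expansion x T T' d moved"
  proof
    show "is_tree T" "junction_property T" "x \<notin> \<Union>(verts T)" "T' \<in> subtrees T" by fact+
    show "b = c" if "b \<in> verts T" "c \<in> verts T" "b \<subseteq> c" for b c using that by (rule antichain)
    show "verts T' \<noteq> {}" using con by (simp add: connected_graph_def)
    show d_sub: "d c \<subseteq> c" if "c \<in> verts T'" for c
      using q_sub[OF that] by (auto simp: d_def sep_union_def)
    show sep: "c \<inter> b \<subseteq> d c" if "{c, b} \<in> edges T'" for b c
      using that by (auto simp: d_def sep_union_def nbrs_def)
    show "b = c" if bc: "b \<in> verts T'" "c \<in> verts T'" "d b \<subseteq> d c" for b c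
    proof (rule ccontr)
      assume "b \<noteq> c"
      have "(b, c) \<in> (adj (edges T'))\<^sup>*" using con bc by (simp add: connected_graph_iff)
      then obtain p where p: "p \<noteq> []" "hd p = b" "last p = c" "distinct p"
        "successively (\<lambda>u v. {u, v} \<in> edges T') p" "set p \<subseteq> insert b (\<Union>(edges T'))"
        by (rule rtrancl_simple_path)
      have "successively (\<lambda>u v. {u, v} \<in> edges T) p"
        by (rule successively_mono[OF p(5)]) (use sub in blast)
      moreover have "insert b (\<Union>(edges T')) \<subseteq> verts T"
        using G(2) sub(1) bc(1) by (auto simp: ugraph_def)
      ultimately have "is_path T p" using p(1,4,6) by (simp add: is_path_def subset_trans)
      then have inter: "b \<inter> c \<subseteq> a" if "a \<in> set p" for a
        using T(2) p(2,3) that unfolding junction_property_def by blast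
      \<comment> \<open>\<open>a\<close> is the second node of the path. The junction property gives
        \<open>d b \<subseteq> b \<inter> a\<close>, so this one separator is all of
        \<open>sep_union T' b\<close> and \<open>q b\<close> is empty, the case that
        \<open>q_choices\<close> excludes.\<close>
      obtain a where a: "a \<in> set p" "{b, a} \<in> edges T'"
        using p \<open>b \<noteq> c\<close> by (cases p rule: remdups_adj.cases) auto
      have "d b \<subseteq> b \<inter> a" using d_sub[OF bc(1)] d_sub[OF bc(2)] bc(3) inter[OF a(1)] by blast
      moreover have "b \<inter> a \<subseteq> sep_union T' b" using a(2) by (auto simp: sep_union_def nbrs_def)
      ultimately have eq: "sep_union T' b = b \<inter> a" and "q b \<subseteq> sep_union T' b"
        by (auto simp: d_def)
      with q_sub[OF bc(1)] have "q b = {}" by blast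
      moreover have "a \<in> nbrs T' b" using a(2) by (simp add: nbrs_def)
      ultimately show False using q[OF bc(1)] eq by (auto simp: q_choices_def split: if_splits)
    qed
    show "{c, b} \<in> edges T \<and> b \<notin> verts T' \<and> b \<inter> c \<subseteq> d c"
      if "c \<in> verts T'" "b \<in> moved c" for b c
      using that n[of c, folded d_def]
      by (auto simp: moved_def n_choices_def nbrs_def d_def split: if_splits)
    show "b \<in> moved c" if "c \<in> verts T'" "d c = c" "{c, b} \<in> edges T" "b \<notin> verts T'" for b c
      using that by (simp add: moved_def nbrs_def)
  qed
  have "Tp = expansion.R x T T' d moved"
    unfolding Tp[folded d_def] rebuild_def Let_def moved_def
      expansion.R_def[OF exp[unfolded moved_def]] expansion.plus_def[OF exp[unfolded moved_def], abs_def]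
    by (rule refl)
  with exp show ?thesis by (rule that)
qed

section \<open>Expansion along the empty subtree\<close>

text \<open>Shows below that the set of possible reconnections is not empty.\<close>

lemma leaf_extension_tree:
  assumes T: "is_tree T" and a: "a \<in> verts T" and v: "v \<notin> verts T"
  shows "is_tree (insert v (verts T), insert {v, a} (edges T))" (is "is_tree ?R")
proof (rule tree_if_card_edges)
  have G: "ugraph T" "connected_graph T" using T by (auto simp: is_tree_def)
  have fin: "finite (verts T)" "finite (edges T)"
    using ugraph_finite_edges[OF G(1)] G(1) by (simp_all add: ugraph_def)
  show "ugraph ?R" using G(1) a v by (auto simp: ugraph_def card_insert_if)
  have va: "(v, a) \<in> (adj (edges ?R))\<^sup>*" by (rule r_into_rtrancl) simp
  have "(u, a) \<in> (adj (edges ?R))\<^sup>*" if "u \<in> verts T" for u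
  proof -
    have "(u, a) \<in> (adj (edges T))\<^sup>*" using G(2) a that by (simp add: connected_graph_iff)
    then show ?thesis by (rule rtrancl_adj_mono) auto
  qed
  with va have to_a: "(u, a) \<in> (adj (edges ?R))\<^sup>*" if "u \<in> verts ?R" for u using that by auto
  have "(u, w) \<in> (adj (edges ?R))\<^sup>*" if "u \<in> verts ?R" "w \<in> verts ?R" for u w
    using to_a[OF that(1)] rtrancl_adj_sym[OF to_a[OF that(2)]] by (rule rtrancl_trans)
  then show "connected_graph ?R" by (simp add: connected_graph_iff)
  have "card (edges ?R) \<le> card (edges T) + 1" by (simp add: card_insert_if fin)
  with tree_card_edges[OF T] show "card (edges ?R) + 1 \<le> card (verts ?R)" using fin v by simp
qed

text \<open>The uniform distribution lives on the intended set of trees only if that set is finite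
  and nonempty. Finiteness holds because all candidates share one finite node set.\<close>

lemma set_expand_empty:
  assumes T: "is_tree T" and a: "a \<in> verts T" "{x} \<notin> verts T"
    and out: "Tp \<in> set_pmf (expand_empty x a T)"
  shows "is_tree Tp" "verts Tp = insert {x} (verts T)" "{e \<in> edges T. \<Inter>e \<noteq> {}} \<subseteq> edges Tp"
proof -
  let ?V = "insert {x} (verts T)" and ?F = "{e \<in> insert {{x}, a} (edges T). \<Inter>e \<noteq> {}}"
  let ?S = "{R. is_tree R \<and> verts R = ?V \<and> ?F \<subseteq> edges R}"
  have "finite ?V" using T by (simp add: is_tree_def ugraph_def)
  then have "finite ({?V} \<times> Pow (Pow ?V))" by simp
  moreover have "?S \<subseteq> {?V} \<times> Pow (Pow ?V)"
  proof
    fix R assume "R \<in> ?S"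
    then have R: "verts R = ?V" "ugraph R" by (simp_all add: is_tree_def)
    then have "e \<in> Pow ?V" if "e \<in> edges R" for e using that by (simp add: ugraph_def)
    then have "edges R \<in> Pow (Pow ?V)" by (rule PowI[OF subsetI])
    with R(1) show "R \<in> {?V} \<times> Pow (Pow ?V)" unfolding mem_Times_iff by simp
  qed
  ultimately have "finite ?S" by (rule finite_subset[rotated])
  \<comment> \<open>Restoring every deleted link, with the new node attached as a leaf, is one
    admissible reconnection.\<close>
  moreover have "(?V, insert {{x}, a} (edges T)) \<in> ?S"
    using leaf_extension_tree[OF T a] by simp blast
  ultimately have "set_pmf (pmf_of_set ?S) = ?S" by (intro set_pmf_of_set) blast+
  with out have "Tp \<in> ?S" by (simp add: expand_empty_def)
  then show "is_tree Tp" "verts Tp = insert {x} (verts T)" "{e \<in> edges T. \<Inter>e \<noteq> {}} \<subseteq> edges Tp"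
    by auto
qed

text \<open>The vertex \<open>x\<close> lies in a single node. For an old vertex \<open>u\<close>,
  links between nodes containing \<open>u\<close> have a nonempty separator and therefore
  survive.\<close>

lemma junction_property_expand_empty:
  assumes T: "is_tree T" "junction_property T" and fresh: "x \<notin> \<Union>(verts T)"
    and R: "is_tree R" "verts R = insert {x} (verts T)" "{e \<in> edges T. \<Inter>e \<noteq> {}} \<subseteq> edges R"
  shows "junction_property R"
proof (rule junction_propertyI[OF R(1)])
  fix u a b assume *: "a \<in> verts R" "b \<in> verts R" "u \<in> a" "u \<in> b"
  show "(a, b) \<in> (adj (links R {u}))\<^sup>*"
  proof (cases "u = x")
    case True
    with * fresh R(2) have "a = b" by blast
    then show ?thesis by simp
  next
    case False
    with * R(2) have "(a, b) \<in> (adj (links T {u}))\<^sup>*"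
      by (intro junction_property_links[OF T]) auto
    moreover have "links T {u} \<subseteq> links R {u}"
      using R(3) by (auto simp: links_def)
    ultimately show ?thesis by (rule rtrancl_adj_mono)
  qed
qed

section \<open>The junction-tree expander\<close>

text \<open>Both cases give a tree with the junction property on an antichain whose nodes, up to
  \<open>x\<close>, lie in old nodes and cover them; the remaining claims follow from
  \<open>underlying_extension\<close>.\<close>

lemma set_expand:
  assumes T: "is_tree T" "junction_property T" "{} \<notin> verts T"
    and antichain: "\<And>b c. b \<in> verts T \<Longrightarrow> c \<in> verts T \<Longrightarrow> b \<subseteq> c \<Longrightarrow> b = c"
    and fin: "\<And>c. c \<in> verts T \<Longrightarrow> finite c"
    and fresh: "x \<notin> \<Union>(verts T)" and a: "a \<in> verts T" and T': "T' \<in> subtrees T"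
    and out: "Tp \<in> set_pmf (expand x a T T')"
  shows "is_tree Tp" "junction_property Tp"
    and "\<And>b c. b \<in> verts Tp \<Longrightarrow> c \<in> verts Tp \<Longrightarrow> b \<subseteq> c \<Longrightarrow> b = c"
    and "\<Union>(verts Tp) = insert x (\<Union>(verts T))"
    and "induced (underlying Tp) (\<Union>(verts T)) = underlying T"
proof -
  have "is_tree Tp \<and> junction_property Tp \<and>
    (\<forall>b\<in>verts Tp. \<forall>c\<in>verts Tp. b \<subseteq> c \<longrightarrow> b = c) \<and> x \<in> \<Union>(verts Tp) \<and>
    (\<forall>p\<in>verts Tp. \<exists>c\<in>verts T. p - {x} \<subseteq> c) \<and> (\<forall>c\<in>verts T. \<exists>p\<in>verts Tp. c \<subseteq> p)"
  proof (cases "T' = ({}, {})")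
    case True
    then have out: "Tp \<in> set_pmf (expand_empty x a T)" using out by (simp add: expand_def)
    have "{x} \<notin> verts T" using fresh by auto
    note Tp = set_expand_empty[OF T(1) a this out]
    from junction_property_expand_empty[OF T(1,2) fresh Tp] have "junction_property Tp" .
    \<comment> \<open>An old node inside \<open>{x}\<close> would be empty or contain
      \<open>x\<close>, and an old node above \<open>{x}\<close> would contain \<open>x\<close>; all
      of this is excluded.\<close>
    moreover have "b = c" if "b \<in> verts Tp" "c \<in> verts Tp" "b \<subseteq> c" for b c
      using that T(3) fresh antichain[of b c] unfolding Tp(2) by (auto simp: subset_singleton_iff)
    ultimately show ?thesis using Tp(1) a unfolding Tp(2) by blast
  next
    case False
    then have out: "Tp \<in> set_pmf (expand_nonempty x T T')" using out by (simp add: expand_def)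
    obtain d moved where exp: "expansion x T T' d moved" "Tp = expansion.R x T T' d moved"
      using antichain fin by (rule expand_nonempty_expansion[OF T(1,2) _ fresh _ T' False out])
    interpret expansion x T T' d moved by fact
    have "\<exists>c\<in>verts T. p - {x} \<subseteq> c" if "p \<in> verts R" for p
      by (rule below[OF that]) (rule bexI)
    then show ?thesis unfolding exp(2)
      by (intro conjI ballI impI tree_R junction_property_R antichain_R fresh_covered above)
  qed
  then have Tp: "is_tree Tp" "junction_property Tp" "x \<in> \<Union>(verts Tp)"
    and anti: "\<forall>b\<in>verts Tp. \<forall>c\<in>verts Tp. b \<subseteq> c \<longrightarrow> b = c"
    and "\<forall>p\<in>verts Tp. \<exists>c\<in>verts T. p - {x} \<subseteq> c" "\<forall>c\<in>verts T. \<exists>p\<in>verts Tp. c \<subseteq> p"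
    by blast+
  then have ext: "\<Union>(verts Tp) - {x} = \<Union>(verts T)"
    "induced (underlying Tp) (\<Union>(verts T)) = underlying T"
    using underlying_extension[OF fresh, of Tp] by simp_all
  show "is_tree Tp" "junction_property Tp" "induced (underlying Tp) (\<Union>(verts T)) = underlying T"
    by fact+
  show "b = c" if "b \<in> verts Tp" "c \<in> verts Tp" "b \<subseteq> c" for b c using anti that by blast
  show "\<Union>(verts Tp) = insert x (\<Union>(verts T))" using ext(1) Tp(3) by blast
qed

theorem theorem1:
  fixes \<alpha> \<beta> :: real
    and y :: "nat \<Rightarrow> 'a"
    and m :: nat
    and att :: "'a set ugraph \<Rightarrow> 'a set"
    and T :: "'a set ugraph"
  assumes "0 < \<alpha>" and "\<alpha> < 1" and "0 < \<beta>" and "\<beta> < 1"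
    and "inj_on y {1..}"
    and "\<And>k R. k \<ge> 1 \<Longrightarrow> R \<in> junction_trees y k \<Longrightarrow> att R \<in> verts R"
    and "m \<ge> 1"
    and "T \<in> junction_trees y m"
  shows "Supp (expander \<alpha> \<beta> att y m T) \<subseteq> junction_trees y (m + 1) \<and>
         (\<forall>Tp \<in> Supp (expander \<alpha> \<beta> att y m T).
            induced (underlying Tp) (y ` {1..m}) = underlying T)"
proof -
  let ?x = "y (m + 1)"
  note T = junction_treesD[OF assms(8,7)]
  have fresh: "?x \<notin> \<Union>(verts T)"
    unfolding T(3) using inj_onD[OF assms(5), of "m + 1"] by fastforce
  have fin: "finite c" if "c \<in> verts T" for c
    by (rule finite_subset[of c "y ` {1..m}"]) (use that T(3) in auto)
  have "Tp \<in> junction_trees y (m + 1) \<and> induced (underlying Tp) (y ` {1..m}) = underlying T"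
    if "Tp \<in> Supp (expander \<alpha> \<beta> att y m T)" for Tp
  proof -
    from that have "expander \<alpha> \<beta> att y m T Tp \<noteq> 0" by (simp add: Supp_def)
    \<comment> \<open>A nonzero sum has a nonzero summand, so \<open>Tp\<close> is a possible output
      for one fixed subtree.\<close>
    then obtain T' where T': "T' \<in> subtrees T" and "pmf (expand ?x (att T) T T') Tp \<noteq> 0"
      unfolding expander_def by (auto elim!: sum.not_neutral_contains_not_neutral)
    then have out: "Tp \<in> set_pmf (expand ?x (att T) T T')" by (simp add: set_pmf_iff)
    note Tp = set_expand[OF T(1,2,5,4) fin fresh assms(6)[OF assms(7,8)] T' out]
    have "{1..m + 1} = insert (m + 1) {1..m}" by auto
    then have "\<Union>(verts Tp) = y ` {1..m + 1}" using Tp(4) T(3) by simp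
    from junction_treesI[OF Tp(1,2) this Tp(3)] Tp(5) T(3) show ?thesis by simp
  qed
  then show ?thesis by blast
qed

end
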